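(* Let $n\in\mathbb{N}$, let $K\subseteq[2,n+1]$, and let $\tau\colon[n+2]\to[n+2]$, $\tau(i):=n+3-i$. Then the following quantities are all equal (in every sum, $J$ and $S$ range over the subsets of $[2,n+1]$ satisfying the indicated condition): \begin{align*} |R([2,n+1]\smallsetminus K)| &=\sum_{J\subseteq[2,n+1]\smallsetminus K}(-1)^{|[2,n+1]\smallsetminus (K\cup J)|}\alpha(J)\hat{!} =\sum_{J\subseteq[2,n+1]\smallsetminus K}(-1)^{n-|K\cup J|}\alpha(J)\hat{!}\\ &=\sum_{J\subseteq[2,n+1]\smallsetminus K}(-1)^{n-|\tau(K)\cup \tau(J)|}\alpha(J)\hat{!} =\sum_{\tau(J)\subseteq[2,n+1]\smallsetminus \tau(K)}(-1)^{n-|\tau(K)\cup\tau(J)|}\alpha(J)\hat{!}\\ &=\sum_{S\subseteq[2,n+1]\smallsetminus \tau(K)}(-1)^{n-|\tau(K)\cup S|}\alpha(\tau(S))\hat{!} =\sum_{S\subseteq\tau(K)}(-1)^{|\tau(K)\smallsetminus S|}\alpha(S)\hat{!}\\ &=\sum_{\tau(J)\subseteq \tau(K)}(-1)^{|\tau(K)\smallsetminus \tau(J)|}\alpha(\tau(J))\hat{!} =\sum_{J\subseteq K}(-1)^{|\tau(K)\smallsetminus \tau(J)|}\alpha(\tau(J))\hat{!}\\ &=\sum_{J\subseteq K}(-1)^{|K\smallsetminus J|}\alpha(\tau(J))\hat{!} =\sum_{\tau(J)\subseteq K}(-1)^{|K\smallsetminus \tau(J)|}\alpha(J)\hat{!}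 =|R(\tau(K))|. \end{align*} Additionally (equivalently, as $K$ ranges over all subsets), for all $K\subseteq[2,n+1]$, $$\sum_{J\subseteq[2,n+1]\smallsetminus K}(-1)^{n-|K\cup J|}\alpha(\tau(J))\hat{!}=\sum_{J\subseteq K}(-1)^{|K\smallsetminus J|}\alpha(J)\hat{!}.$$
   Context: Notation: $[m]=\{1,\dots,m\}$ and $[a,b]=\{a,a+1,\dots,b\}$ (empty if $a>b$). $\mathfrak{S}_{n+1}$ is the symmetric group on $[n+1]$, with permutations written in one-line notation $\sigma=(\sigma_1\cdots\sigma_{n+1})$. The descent top set of $\sigma\in\mathfrak{S}_{n+1}$ is $\mathcal{DT}(\sigma)=\{\sigma_i \mid i\in[n],\ \sigma_i>\sigma_{i+1}\}\subseteq[2,n+1]$. For $S\subseteq[n+1]$, $R(S)=R(n,S):=\{\sigma\in\mathfrak{S}_{n+1}\mid \mathcal{DT}(\sigma)=S\}$. For a finite set of positive integers $X=\{x_1<\dots<x_k\}$, $\alpha(X):=(x_1-1,\,x_2-x_1,\,x_3-x_2,\dots,x_k-x_{k-1})$. For a tuple $\beta=(\beta_1,\dots,\beta_k)$ of nonnegative integers, $\beta\hat{!}:=(k+1)^{\beta_1}k^{\beta_2}\cdots 3^{\beta_{k-1}}2^{\beta_k}$. By convention $\alpha(\emptyset)=()$ and $()\hat{!}=1$. For a set $W$, $\tau(W)=\{\tau(w)\mid w\in W\}$. *)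

theory Defs
  imports "HOL-Combinatorics.Permutations"
begin

text \<open>
  Elements of the symmetric group on \<open>{1..n+1}\<close> are functions \<open>\<sigma>\<close> with
  \<open>\<sigma> permutes {1..n+1}\<close>, whose one-line notation is \<open>\<sigma> 1, \<dots>, \<sigma> (n+1)\<close>.
\<close>

definition descent_tops :: "nat \<Rightarrow> (nat \<Rightarrow> nat) \<Rightarrow> nat set" where
  "descent_tops n \<sigma> = {\<sigma> i | i. i \<in> {1..n} \<and> \<sigma> i > \<sigma> (i + 1)}"

definition perms_with_descent_tops :: "nat \<Rightarrow> nat set \<Rightarrow> (nat \<Rightarrow> nat) set" where
  "perms_with_descent_tops n S = {\<sigma>. \<sigma> permutes {1..n+1} \<and> descent_tops n \<sigma> = S}"

text \<open>
  For \<open>X = {x\<^sub>1 < \<dots> < x\<^sub>k}\<close> the two zipped lists are \<open>x\<^sub>1, \<dots>, x\<^sub>k\<close> and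
  \<open>1, x\<^sub>1, \<dots>, x\<^sub>k\<close>; zipping drops the last entry of the second one.  The truncated
  subtraction is exact because \<open>X\<close> is meant to consist of positive numbers.
\<close>

definition alpha :: "nat set \<Rightarrow> nat list" where
  "alpha X = (let xs = sorted_list_of_set X in map2 (-) xs (1 # xs))"

text \<open>The list index \<open>j\<close> is 0-based, so the factor for \<open>\<beta>\<^sub>j\<^sub>+\<^sub>1\<close> has base \<open>k + 1 - j\<close>.\<close>

definition hat_fact :: "nat list \<Rightarrow> nat" where
  "hat_fact \<beta> = (\<Prod>j<length \<beta>. (length \<beta> + 1 - j) ^ (\<beta> ! j))"

text \<open>The reflection is only ever applied to elements of \<open>{1..n+2}\<close>, where it is an involution.\<close>

definition tau :: "nat \<Rightarrow> nat \<Rightarrow> nat" where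
  "tau n i = n + 3 - i"

end

theory Submission
  imports Defs "HOL-Combinatorics.Multiset_Permutations"
begin

text \<open>
  The proof works with permutations written as words, i.e. distinct lists.  Three ideas carry it.

  \<^item> \<^emph>\<open>Counting by insertion\<close> (\<open>card_words_tops_subset\<close>).  Build a word by inserting its letters from
    the largest to the smallest.  A letter that is smaller than everything present is never a
    descent top, but it turns the letter on its left into one.  Hence the words with all
    descent tops in \<open>J\<close> arise by inserting \<open>m\<close> either at the front or directly
    behind a letter of \<open>J\<close>, which leaves \<open>1 + |{x \<in> J. m < x}|\<close> choices.  Grouping equal factors,
    the product of these numbers is \<open>hat_fact (alpha J)\<close>.

  \<^item> \<^emph>\<open>Symmetry\<close> (\<open>word_tops_swap_around_min\<close>).  Read \<open>n + 2\<close> followed by a word on \<open>{1..n+1}\<close>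
    cyclically, apply \<open>\<tau>\<close>, and cut the circle open at \<open>n + 2\<close> again.  Reversing the
    order of the alphabet turns cyclic descents into cyclic ascents, so descent tops are
    complemented and reflected.  On words this is the involution
    \<open>u 1 v \<mapsto> \<tau>(v) 1 \<tau>(u)\<close>, and it gives \<open>|R([2,n+1] - K)| = |R(\<tau>(K))|\<close>.

  \<^item> \<^emph>\<open>Moebius inversion\<close> over the subsets of a finite set turns the count of words with descent tops
    \<^emph>\<open>inside\<close> a set into an alternating sum for \<open>|R(S)|\<close> (\<open>card_perms_with_descent_tops\<close>).

  All the sums are then this alternating sum, taken for \<open>[2,n+1] - K\<close> or for \<open>\<tau>(K)\<close>, reindexed by
  the bijection that \<open>\<tau>\<close> induces on the subsets of \<open>[2,n+1]\<close>.
\<close>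

section \<open>Descent tops of words\<close>

fun word_tops :: "'a::linorder list \<Rightarrow> 'a set" where
  "word_tops (a # b # w) = (if b < a then {a} else {}) \<union> word_tops (b # w)"
| "word_tops w = {}"

lemma word_tops_append:
  "word_tops (u @ v) = word_tops u \<union> word_tops v \<union>
     (if u \<noteq> [] \<and> v \<noteq> [] \<and> hd v < last u then {last u} else {})"
proof (induction u rule: word_tops.induct)
  case ("2_2" a)
  then show ?case by (cases v) auto
qed auto

lemma word_tops_subset: "word_tops w \<subseteq> set w"
  by (induction w rule: word_tops.induct) auto

lemma word_tops_Cons_min:
  assumes "\<forall>x\<in>set v. m < x"
  shows "word_tops (m # v) = word_tops v"
  using assms by (cases v) auto

lemma word_tops_map_upt:
  "word_tops (map \<sigma> [a..<b]) = {\<sigma> i | i. a \<le> i \<and> i + 1 < b \<and> \<sigma> (i + 1) < \<sigma> i}"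
proof (induction b)
  case (Suc b)
  show ?case
  proof (cases "a < b")
    case True
    then obtain c where c: "b = Suc c" "a \<le> c" by (metis less_Suc_eq_le lessE)
    have "word_tops (map \<sigma> [a..<Suc b]) = {\<sigma> i | i. a \<le> i \<and> i + 1 < b \<and> \<sigma> (i + 1) < \<sigma> i} \<union>
        (if \<sigma> b < \<sigma> c then {\<sigma> c} else {})"
      using Suc.IH c by (simp add: word_tops_append)
    also have "\<dots> = {\<sigma> i | i. a \<le> i \<and> i + 1 < Suc b \<and> \<sigma> (i + 1) < \<sigma> i}"
      using c by (auto simp: less_Suc_eq)
    finally show ?thesis .
  qed (auto simp: not_less le_Suc_eq)
qed simp

text \<open>
  A permutation is determined by its values on the interval, and surjectivity follows because there
  are equally many permutations and distinct words.
\<close>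

lemma bij_betw_one_line_notation:
  "bij_betw (\<lambda>\<sigma>. map \<sigma> [a..<b]) {\<sigma>. \<sigma> permutes {a..<b}} (permutations_of_set {a..<b})"
proof -
  let ?P = "{\<sigma>. \<sigma> permutes {a..<b}}" and ?f = "\<lambda>\<sigma>. map \<sigma> [a..<b]"
  have inj: "inj_on ?f ?P"
  proof (rule inj_onI)
    fix \<sigma> \<rho> assume *: "\<sigma> \<in> ?P" "\<rho> \<in> ?P" "?f \<sigma> = ?f \<rho>"
    show "\<sigma> = \<rho>"
    proof
      fix x
      show "\<sigma> x = \<rho> x"
        using * by (cases "x \<in> {a..<b}") (auto simp: permutes_not_in)
    qed
  qed
  have sub: "?f ` ?P \<subseteq> permutations_of_set {a..<b}"
    by (auto intro!: permutations_of_setI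
        simp: permutes_image distinct_map permutes_inj_on simp flip: atLeastLessThan_iff)
  have "card (?f ` ?P) = card (permutations_of_set {a..<b})"
    using inj by (simp add: card_image card_permutations[OF refl])
  with sub have "?f ` ?P = permutations_of_set {a..<b}"
    by (intro card_subset_eq) auto
  with inj show ?thesis by (simp add: bij_betw_def)
qed

lemma card_perms_eq_card_words:
  "card (perms_with_descent_tops n S) = card {w \<in> permutations_of_set {1..n+1}. word_tops w = S}"
proof -
  have tops: "descent_tops n \<sigma> = word_tops (map \<sigma> [1..<n+2])" for \<sigma>
    unfolding descent_tops_def word_tops_map_upt by (intro Collect_cong) auto
  have ivl: "{1..n+1} = {1..<n+2}" by auto
  have "bij_betw (\<lambda>\<sigma>. map \<sigma> [1..<n+2]) (perms_with_descent_tops n S)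
          {w \<in> permutations_of_set {1..n+1}. word_tops w = S}"
    unfolding perms_with_descent_tops_def tops ivl
    using bij_betw_Collect[OF bij_betw_one_line_notation[of 1 "n+2"],
        of "\<lambda>w. word_tops w = S" "\<lambda>\<sigma>. word_tops (map \<sigma> [1..<n+2]) = S"] by simp
  then show ?thesis by (rule bij_betw_same_card)
qed

section \<open>Words whose descent tops lie in a given set\<close>

text \<open>
  A new minimal letter \<open>m\<close> makes its left neighbour a descent top and leaves the status of every
  other letter unchanged, so only the left neighbour has to be checked.  Conversely, if that
  neighbour lies in \<open>J\<close>, it is irrelevant whether it was a descent top before.
\<close>

lemma word_tops_insert_min_subset_iff:
  assumes "\<forall>x\<in>set u \<union> set v. m < x"
  shows "word_tops (u @ m # v) \<subseteq> J \<longleftrightarrow> word_tops (u @ v) \<subseteq> J \<and> (u = [] \<or> last u \<in> J)"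
proof (cases "u = []")
  case False
  then have "m < last u" using assms by auto
  with False show ?thesis
    using assms by (auto simp: word_tops_append word_tops_Cons_min split: if_splits)
qed (use assms in \<open>simp add: word_tops_Cons_min\<close>)

lemma card_words_insert_min:
  fixes m :: "'a::linorder"
  assumes "finite A" and min: "\<forall>x\<in>A. m < x"
  shows "card {w \<in> permutations_of_set (insert m A). word_tops w \<subseteq> J}
       = (1 + card (J \<inter> A)) * card {w \<in> permutations_of_set A. word_tops w \<subseteq> J}"
proof -
  let ?L = "{w \<in> permutations_of_set A. word_tops w \<subseteq> J}"
  let ?L' = "{w \<in> permutations_of_set (insert m A). word_tops w \<subseteq> J}"
  \<comment> \<open>\<open>k\<close> is the position of \<open>m\<close> in the new word, so the letter in front of \<open>m\<close> is \<open>w ! (k - 1)\<close>.\<close>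
  let ?pos = "\<lambda>w. insert 0 (Suc ` {i. i < length w \<and> w ! i \<in> J})"
  let ?ins = "\<lambda>(w, k). take k w @ m # drop k w"
  have m: "m \<notin> A" using min by blast
  have bij: "bij_betw ?ins (Sigma ?L ?pos) ?L'"
    unfolding bij_betw_def
  proof
    show "inj_on ?ins (Sigma ?L ?pos)"
    proof (rule inj_onI, clarify)
      fix w k w' k'
      assume w: "w \<in> permutations_of_set A" and w': "w' \<in> permutations_of_set A"
        and k: "k \<in> ?pos w" "k' \<in> ?pos w'"
        and eq: "take k w @ m # drop k w = take k' w' @ m # drop k' w'"
      have "m \<notin> set w" using w m by (auto simp: permutations_of_set_def)
      then have "m \<notin> set (take k w)" "m \<notin> set (drop k w)"
        by (auto dest: in_set_takeD in_set_dropD)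
      then have td: "take k w = take k' w'" "drop k w = drop k' w'"
        using eq by (simp_all add: append_Cons_eq_iff)
      then have "w = w'" by (metis append_take_drop_id)
      moreover have "k = k'"
        using arg_cong[OF td(1), of length] k by auto
      ultimately show "w = w' \<and> k = k'" by simp
    qed
    show "?ins ` Sigma ?L ?pos = ?L'"
    proof (intro equalityI subsetI)
      fix x assume "x \<in> ?ins ` Sigma ?L ?pos"
      then obtain w k where w: "w \<in> ?L" and k: "k \<in> ?pos w"
        and x: "x = take k w @ m # drop k w" by auto
      have set: "set (take k w) \<union> set (drop k w) = A" and dist: "distinct (take k w @ drop k w)"
        using w by (auto simp: permutations_of_set_def simp flip: set_append)
      have "take k w = [] \<or> last (take k w) \<in> J"
        using k by (auto simp: take_Suc_conv_app_nth)
      then have "word_tops x \<subseteq> J"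
        using word_tops_insert_min_subset_iff[of "take k w" "drop k w" m J] w min set x by auto
      moreover have "x \<in> permutations_of_set (insert m A)"
        using set dist m x by (intro permutations_of_setI) (auto simp del: append_take_drop_id)
      ultimately show "x \<in> ?L'" by simp
    next
      fix x assume x: "x \<in> ?L'"
      then have "m \<in> set x" by (auto simp: permutations_of_set_def)
      then obtain u v where uv: "x = u @ m # v" by (meson split_list)
      have set: "set (u @ v) = A" and dist: "distinct (u @ v)"
        using x uv m by (auto simp: permutations_of_set_def)
      have tops: "word_tops (u @ v) \<subseteq> J" "u = [] \<or> last u \<in> J"
        using word_tops_insert_min_subset_iff[of u v m J] x uv set min by auto
      have "length u \<in> ?pos (u @ v)"
      proof (cases u rule: rev_cases)
        case (snoc u' a)
        then show ?thesis using tops(2) by (auto simp: nth_append intro!: imageI)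
      qed simp
      moreover have "u @ v \<in> ?L"
        using set dist tops by (auto intro: permutations_of_setI)
      ultimately show "x \<in> ?ins ` Sigma ?L ?pos"
        using uv by (intro image_eqI[where x = "(u @ v, length u)"]) auto
    qed
  qed
  have pos: "card (?pos w) = 1 + card (J \<inter> A)" if "w \<in> ?L" for w
  proof -
    have "set w = A" "distinct w" using that by (auto simp: permutations_of_set_def)
    then have "bij_betw (\<lambda>i. w ! i) {i. i < length w \<and> w ! i \<in> J} (J \<inter> A)"
      by (auto simp: bij_betw_def inj_on_def nth_eq_iff_index_eq in_set_conv_nth)
    then have "card {i. i < length w \<and> w ! i \<in> J} = card (J \<inter> A)" by (rule bij_betw_same_card)
    then show ?thesis by (simp add: card_insert_if card_image)
  qed
  have "card ?L' = card (Sigma ?L ?pos)" using bij_betw_same_card[OF bij] by simp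
  also have "\<dots> = (\<Sum>w\<in>?L. card (?pos w))" by (rule card_SigmaI) auto
  also have "\<dots> = (1 + card (J \<inter> A)) * card ?L" using pos by simp
  finally show ?thesis .
qed

text \<open>
  Inserting the letters from the largest to the smallest keeps the number of choices
  for each letter independent of the choices made before.
\<close>

lemma card_words_tops_subset:
  fixes A :: "'a::linorder set"
  assumes "finite A"
  shows "card {w \<in> permutations_of_set A. word_tops w \<subseteq> J}
       = (\<Prod>k\<in>A. 1 + card {x \<in> J \<inter> A. k < x})"
  using assms
proof (induction A rule: finite_linorder_min_induct)
  case empty
  have "{w. w = [] \<and> word_tops w \<subseteq> J} = {[]}" by auto
  then show ?case by simp
next
  case (insert m A)
  have "{x \<in> J \<inter> insert m A. m < x} = J \<inter> A" using insert.hyps by auto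
  moreover have "{x \<in> J \<inter> insert m A. k < x} = {x \<in> J \<inter> A. k < x}" if "k \<in> A" for k
    using insert.hyps that by auto
  moreover have "m \<notin> A" using insert.hyps by auto
  ultimately have "(\<Prod>k\<in>insert m A. 1 + card {x \<in> J \<inter> insert m A. k < x})
      = (1 + card (J \<inter> A)) * (\<Prod>k\<in>A. 1 + card {x \<in> J \<inter> A. k < x})"
    using insert.hyps by simp
  then show ?case using card_words_insert_min[of A m J] insert by simp
qed

lemma hat_fact_Cons: "hat_fact (b # \<beta>) = (length \<beta> + 2) ^ b * hat_fact \<beta>"
  by (simp add: hat_fact_def prod.lessThan_Suc_shift del: prod.lessThan_Suc)

text \<open>
  Between consecutive elements of \<open>J\<close> the number of larger elements of \<open>J\<close> is constant; the
  entries of \<open>alpha J\<close> are the lengths of these intervals, the first of them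
  starting at \<open>1\<close>.  The starting point \<open>s\<close> is a parameter to allow induction.
\<close>

lemma hat_fact_differences:
  assumes "sorted_wrt (<) xs" "\<forall>x\<in>set xs. s \<le> x \<and> x \<le> N"
  shows "hat_fact (map2 (-) xs (s # xs)) = (\<Prod>k\<in>{s..N}. 1 + card {x \<in> set xs. k < x})"
  using assms
proof (induction xs arbitrary: s)
  case Nil
  then show ?case by (simp add: hat_fact_def)
next
  case (Cons x xs)
  let ?c = "\<lambda>k. 1 + card {y \<in> set (x # xs). k < y}"
  have x: "s \<le> x" "x \<le> N" "\<forall>y\<in>set xs. x < y" "distinct xs"
    using Cons.prems by (auto simp: strict_sorted_iff)
  have "?c k = length xs + 2" if "k \<in> {s..<x}" for k
  proof -
    have "{y \<in> set (x # xs). k < y} = set (x # xs)" using that x by auto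
    then show ?thesis using x distinct_card[of "x # xs"] by auto
  qed
  then have low: "(\<Prod>k\<in>{s..<x}. ?c k) = (length xs + 2) ^ (x - s)" by simp
  have "{y \<in> set (x # xs). k < y} = {y \<in> set xs. k < y}" if "k \<in> {x..N}" for k
    using that by auto
  then have "(\<Prod>k\<in>{x..N}. ?c k) = (\<Prod>k\<in>{x..N}. 1 + card {y \<in> set xs. k < y})"
    by (intro prod.cong refl) metis
  then have high: "(\<Prod>k\<in>{x..N}. ?c k) = hat_fact (map2 (-) xs (x # xs))"
    using Cons.IH[of x] Cons.prems by (simp add: less_imp_le)
  have "{s..N} = {s..<x} \<union> {x..N}" using x by auto
  then have "(\<Prod>k\<in>{s..N}. ?c k) = (\<Prod>k\<in>{s..<x}. ?c k) * (\<Prod>k\<in>{x..N}. ?c k)"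
    by (simp add: prod.union_disjoint ivl_disj_int)
  then show ?case unfolding low high by (simp add: hat_fact_Cons)
qed

lemma hat_fact_alpha:
  assumes "J \<subseteq> {1..N}"
  shows "hat_fact (alpha J) = (\<Prod>k\<in>{1..N}. 1 + card {x \<in> J. k < x})"
proof -
  have "finite J" using assms finite_subset by blast
  then show ?thesis
    using assms hat_fact_differences[of "sorted_list_of_set J" 1 N]
    by (simp add: alpha_def Let_def subset_iff)
qed

lemma card_words_tops_subset_hat_fact:
  assumes "J \<subseteq> {1..N}"
  shows "card {w \<in> permutations_of_set {1..N}. word_tops w \<subseteq> J} = hat_fact (alpha J)"
  using assms by (simp add: card_words_tops_subset hat_fact_alpha Int_absorb2)

section \<open>Reversing the order of the alphabet\<close>

text \<open>
  Reversing the order of the alphabet exchanges descents and ascents.  The last letter of a word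
  starts neither; a smaller letter \<open>z\<close> appended on one side only makes it a descent top there, so
  that the two sets of descent tops become exact complements.
\<close>

lemma word_tops_map_antitone:
  assumes "distinct u" "\<forall>x\<in>set u. \<forall>y\<in>set u. x < y \<longrightarrow> h y < h x" "\<forall>x\<in>set u. z < x"
  shows "word_tops (map h u) = h ` (set u - word_tops (u @ [z]))"
  using assms
proof (induction u rule: word_tops.induct)
  case (1 a b w)
  have "a \<notin> word_tops (b # w @ [z])"
    using "1.prems" word_tops_subset[of "b # w @ [z]"] by auto
  moreover have "h b < h a \<longleftrightarrow> \<not> b < a"
    using "1.prems" by (auto simp: not_less le_less dest: less_asym)
  ultimately show ?case using "1.IH" "1.prems" by (auto simp: insert_Diff_if)
qed auto

lemma word_tops_map_antitone_append:
  assumes "distinct v" "\<forall>x\<in>set v. \<forall>y\<in>set v. x < y \<longrightarrow> h y < h x" "\<forall>x\<in>set v. z < h x"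
  shows "word_tops (map h v @ [z]) = h ` (set v - word_tops v)"
  using assms
proof (induction v rule: word_tops.induct)
  case (1 a b w)
  have "a \<notin> word_tops (b # w)"
    using "1.prems" word_tops_subset[of "b # w"] by auto
  moreover have "h b < h a \<longleftrightarrow> \<not> b < a"
    using "1.prems" by (auto simp: not_less le_less dest: less_asym)
  ultimately show ?case using "1.IH" "1.prems" by (auto simp: insert_Diff_if)
qed auto

text \<open>
  The minimal letter \<open>m\<close> cuts the word into two factors; it makes the last letter of the left one a
  descent top and leaves the right one alone.  Exchanging the factors while reversing the
  order therefore complements the descent tops on both of them.
\<close>

lemma word_tops_swap_around_min:
  assumes "distinct (u @ v)"
    and anti: "\<forall>x\<in>set u \<union> set v. \<forall>y\<in>set u \<union> set v. x < y \<longrightarrow> h y < h x"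
    and min: "\<forall>x\<in>set u \<union> set v. m < x \<and> m < h x"
  shows "word_tops (map h v @ m # map h u) = h ` (set u \<union> set v - word_tops (u @ m # v))"
proof -
  have split: "word_tops (a @ m # b) = word_tops (a @ [m]) \<union> word_tops b"
    if "\<forall>x\<in>set b. m < x" for a b
    using that by (auto simp: word_tops_append word_tops_Cons_min)
  have "word_tops (map h v @ m # map h u)
      = h ` (set v - word_tops v) \<union> h ` (set u - word_tops (u @ [m]))"
    using assms split[of "map h u" "map h v"] word_tops_map_antitone[of u h m]
      word_tops_map_antitone_append[of v h m] by auto
  also have "\<dots> = h ` (set u \<union> set v - (word_tops (u @ [m]) \<union> word_tops v))"
  proof -
    have "word_tops (u @ [m]) \<inter> set v = {}" "word_tops v \<inter> set u = {}"
      using assms word_tops_subset[of "u @ [m]"] word_tops_subset[of v] by auto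
    then show ?thesis by blast
  qed
  also have "word_tops (u @ [m]) \<union> word_tops v = word_tops (u @ m # v)"
    using split[of v u] min by simp
  finally show ?thesis .
qed

definition swap_around :: "'a \<Rightarrow> ('a \<Rightarrow> 'a) \<Rightarrow> 'a list \<Rightarrow> 'a list" where
  "swap_around m h w =
     map h (tl (dropWhile (\<lambda>x. x \<noteq> m) w)) @ m # map h (takeWhile (\<lambda>x. x \<noteq> m) w)"

lemma swap_around_append:
  assumes "m \<notin> set u"
  shows "swap_around m h (u @ m # v) = map h v @ m # map h u"
proof -
  have "dropWhile (\<lambda>x. x \<noteq> m) (u @ m # v) = m # v"
    using assms by (subst dropWhile_append2) auto
  moreover have "takeWhile (\<lambda>x. x \<noteq> m) (u @ m # v) = u"
    using assms by (subst takeWhile_append2) auto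
  ultimately show ?thesis by (simp add: swap_around_def)
qed

text \<open>
  On the words with letters \<open>insert m A\<close>, exchanging the factors around \<open>m\<close> is an involution
  because \<open>h\<close> is one on \<open>A\<close>, so it matches the words with the two sets of descent tops.
\<close>

lemma card_words_tops_complement:
  fixes m :: "'a::linorder"
  assumes min: "\<forall>x\<in>A. m < x"
    and maps: "\<And>x. x \<in> A \<Longrightarrow> h x \<in> A" and inv: "\<And>x. x \<in> A \<Longrightarrow> h (h x) = x"
    and anti: "\<And>x y. x \<in> A \<Longrightarrow> y \<in> A \<Longrightarrow> x < y \<Longrightarrow> h y < h x"
    and "K \<subseteq> A"
  shows "card {w \<in> permutations_of_set (insert m A). word_tops w = A - K}
       = card {w \<in> permutations_of_set (insert m A). word_tops w = h ` K}"
proof -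
  let ?P = "permutations_of_set (insert m A)"
  have m: "m \<notin> A" using min by blast
  have inj: "inj_on h A" using inv by (rule inj_on_inverseI)
  have hA: "h ` A = A" using maps inv by force
  have swap: "swap_around m h w \<in> ?P \<and> swap_around m h (swap_around m h w) = w \<and>
      word_tops (swap_around m h w) = h ` (A - word_tops w)" if w: "w \<in> ?P" for w
  proof -
    have "m \<in> set w" using w by (auto simp: permutations_of_set_def)
    then obtain u v where uv: "w = u @ m # v" by (meson split_list)
    have A: "set u \<union> set v = A" and dist: "distinct (u @ v)" and mu: "m \<notin> set u"
      using w uv m by (auto simp: permutations_of_set_def)
    have eq: "swap_around m h w = map h v @ m # map h u"
      using mu uv by (simp add: swap_around_append)
    have "m \<notin> h ` set v" "m \<notin> h ` set u" using maps A m by fastforce+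
    moreover have "inj_on h (set u)" "inj_on h (set v)" "h ` set u \<inter> h ` set v = {}"
      using inj dist unfolding A[symmetric] by (auto simp: inj_on_def)
    moreover have "h ` set u \<union> h ` set v = A" using hA A by (simp add: image_Un[symmetric])
    ultimately have "swap_around m h w \<in> ?P"
      unfolding eq using dist by (intro permutations_of_setI) (auto simp: distinct_map)
    moreover have "swap_around m h (swap_around m h w) = w"
    proof -
      have "map (h \<circ> h) u = u" "map (h \<circ> h) v = v"
        using A inv by (auto intro!: map_idI)
      then show ?thesis
        unfolding eq using \<open>m \<notin> h ` set v\<close> by (simp add: swap_around_append uv)
    qed
    moreover have "word_tops (swap_around m h w) = h ` (A - word_tops w)"
      unfolding eq unfolding uv A[symmetric]
      using dist anti min maps A by (intro word_tops_swap_around_min) auto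
    ultimately show ?thesis by blast
  qed
  have "A - (A - K) = K" using \<open>K \<subseteq> A\<close> by blast
  moreover have "h ` (A - h ` K) = A - K"
  proof -
    have "h ` h ` K = K" using \<open>K \<subseteq> A\<close> inv by force
    moreover have "h ` K \<subseteq> A" using \<open>K \<subseteq> A\<close> maps by blast
    ultimately show ?thesis using inj hA by (simp add: inj_on_image_set_diff)
  qed
  ultimately have "bij_betw (swap_around m h)
      {w \<in> ?P. word_tops w = A - K} {w \<in> ?P. word_tops w = h ` K}"
    using swap by (intro bij_betw_byWitness[where f' = "swap_around m h"]) auto
  then show ?thesis by (rule bij_betw_same_card)
qed

section \<open>Alternating sums and the reflection\<close>

text \<open>
  The words with all descent tops in \<open>S\<close> are sorted by their exact set of descent tops; Moebius
  inversion recovers the size of the class of \<open>S\<close> from the known counts for its subsets.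
\<close>

lemma card_perms_with_descent_tops:
  assumes "S \<subseteq> {2..n+1}"
  shows "int (card (perms_with_descent_tops n S))
       = (\<Sum>J | J \<subseteq> S. (-1) ^ card (S - J) * int (hat_fact (alpha J)))"
proof -
  let ?P = "permutations_of_set {1..n+1}"
  let ?exact = "\<lambda>T. int (card {w \<in> ?P. word_tops w = T})"
  let ?within = "\<lambda>T. int (card {w \<in> ?P. word_tops w \<subseteq> T})"
  have fin: "finite S" using assms finite_subset by blast
  have "?within T = sum ?exact (Pow T)" if "finite T" for T
  proof -
    have "{w \<in> ?P. word_tops w \<subseteq> T} = (\<Union>T'\<in>Pow T. {w \<in> ?P. word_tops w = T'})" by auto
    then show ?thesis
      using that by (simp add: card_UN_disjoint disjoint_iff)
  qed
  then have "?exact S = (\<Sum>J\<in>Pow S. (-1) ^ (card S - card J) * ?within J)"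
    using fin by (rule inclusion_exclusion_mobius)
  also have "\<dots> = (\<Sum>J\<in>Pow S. (-1) ^ card (S - J) * int (hat_fact (alpha J)))"
  proof (rule sum.cong[OF refl])
    fix J assume "J \<in> Pow S"
    then have J: "J \<subseteq> S" "J \<subseteq> {1..n+1}" using assms by auto
    then have "card S - card J = card (S - J)"
      using fin by (simp add: card_Diff_subset finite_subset)
    then show "(-1) ^ (card S - card J) * ?within J
        = (-1) ^ card (S - J) * int (hat_fact (alpha J))"
      using card_words_tops_subset_hat_fact[OF J(2)] by simp
  qed
  finally show ?thesis by (simp add: card_perms_eq_card_words Pow_def)
qed

lemma tau_in: "i \<in> {2..n+1} \<Longrightarrow> tau n i \<in> {2..n+1}"
  by (auto simp: tau_def)

lemma tau_tau: "i \<in> {2..n+1} \<Longrightarrow> tau n (tau n i) = i"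
  by (auto simp: tau_def)

lemma tau_image_subset: "A \<subseteq> {2..n+1} \<Longrightarrow> tau n ` A \<subseteq> {2..n+1}"
  using tau_in by blast

lemma tau_image_image: "A \<subseteq> {2..n+1} \<Longrightarrow> tau n ` tau n ` A = A"
  using tau_tau by force

lemma inj_on_tau: "inj_on (tau n) {2..n+1}"
  using tau_tau by (rule inj_on_inverseI)

lemma card_tau_image: "A \<subseteq> {2..n+1} \<Longrightarrow> card (tau n ` A) = card A"
  by (intro card_image inj_on_subset[OF inj_on_tau])

lemma tau_image_Diff:
  assumes "A \<subseteq> {2..n+1}" "B \<subseteq> {2..n+1}"
  shows "tau n ` (A - B) = tau n ` A - tau n ` B"
  using inj_on_image_set_diff[OF inj_on_tau, of A B] assms by blast

lemma tau_image_interval: "tau n ` {2..n+1} = {2..n+1}"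
  using tau_image_subset[of "{2..n+1}" n] tau_image_image[of "{2..n+1}" n]
  by (metis image_mono order_refl subset_antisym)

lemma tau_image_subset_iff:
  assumes "A \<subseteq> {2..n+1}" "B \<subseteq> {2..n+1}"
  shows "tau n ` A \<subseteq> tau n ` B \<longleftrightarrow> A \<subseteq> B"
  using tau_image_image assms by (metis image_mono)

lemma sum_subsets_tau_image:
  assumes "A \<subseteq> {2..n+1}"
  shows "(\<Sum>S | S \<subseteq> tau n ` A. g S) = (\<Sum>J | J \<subseteq> A. g (tau n ` J))"
proof (rule sum.reindex_bij_betw[symmetric])
  show "bij_betw ((`) (tau n)) {J. J \<subseteq> A} {S. S \<subseteq> tau n ` A}"
    unfolding Pow_def[symmetric]
    using inj_on_subset[OF inj_on_tau assms] by (intro bij_betw_Pow bij_betw_imageI) auto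
qed

lemma card_perms_with_descent_tops_complement:
  assumes "K \<subseteq> {2..n+1}"
  shows "card (perms_with_descent_tops n ({2..n+1} - K)) = card (perms_with_descent_tops n (tau n ` K))"
proof -
  have "{1..n+1} = insert 1 {2..n+1}" by auto
  then show ?thesis
    unfolding card_perms_eq_card_words
    by (simp only:) (rule card_words_tops_complement, use assms in \<open>auto simp: tau_def\<close>)
qed

theorem corollary7p1:
  fixes n :: nat and K :: "nat set"
  assumes "K \<subseteq> {2..n+1}"
  shows
    "(let r = int (card (perms_with_descent_tops n ({2..n+1} - K))) in
        r = (\<Sum>J | J \<subseteq> {2..n+1} - K.
               (-1) ^ card ({2..n+1} - (K \<union> J)) * int (hat_fact (alpha J)))
      \<and> r = (\<Sum>J | J \<subseteq> {2..n+1} - K.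
               (-1) ^ (n - card (K \<union> J)) * int (hat_fact (alpha J)))
      \<and> r = (\<Sum>J | J \<subseteq> {2..n+1} - K.
               (-1) ^ (n - card (tau n ` K \<union> tau n ` J)) * int (hat_fact (alpha J)))
      \<and> r = (\<Sum>J | J \<subseteq> {2..n+1} \<and> tau n ` J \<subseteq> {2..n+1} - tau n ` K.
               (-1) ^ (n - card (tau n ` K \<union> tau n ` J)) * int (hat_fact (alpha J)))
      \<and> r = (\<Sum>S | S \<subseteq> {2..n+1} - tau n ` K.
               (-1) ^ (n - card (tau n ` K \<union> S)) * int (hat_fact (alpha (tau n ` S))))
      \<and> r = (\<Sum>S | S \<subseteq> {2..n+1} \<and> S \<subseteq> tau n ` K.
               (-1) ^ card (tau n ` K - S) * int (hat_fact (alpha S)))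
      \<and> r = (\<Sum>J | J \<subseteq> {2..n+1} \<and> tau n ` J \<subseteq> tau n ` K.
               (-1) ^ card (tau n ` K - tau n ` J) * int (hat_fact (alpha (tau n ` J))))
      \<and> r = (\<Sum>J | J \<subseteq> {2..n+1} \<and> J \<subseteq> K.
               (-1) ^ card (tau n ` K - tau n ` J) * int (hat_fact (alpha (tau n ` J))))
      \<and> r = (\<Sum>J | J \<subseteq> {2..n+1} \<and> J \<subseteq> K.
               (-1) ^ card (K - J) * int (hat_fact (alpha (tau n ` J))))
      \<and> r = (\<Sum>J | J \<subseteq> {2..n+1} \<and> tau n ` J \<subseteq> K.
               (-1) ^ card (K - tau n ` J) * int (hat_fact (alpha J)))
      \<and> r = int (card (perms_with_descent_tops n (tau n ` K))))
     \<and> (\<Sum>J | J \<subseteq> {2..n+1} - K.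
               (-1) ^ (n - card (K \<union> J)) * int (hat_fact (alpha (tau n ` J))))
       = (\<Sum>J | J \<subseteq> {2..n+1} \<and> J \<subseteq> K.
               (-1) ^ card (K - J) * int (hat_fact (alpha J)))"
proof -
  let ?I = "{2..n+1}" and ?F = "\<lambda>J. int (hat_fact (alpha J))"
  define r where "r = int (card (perms_with_descent_tops n (?I - K)))"
  note K = assms
  have tK: "tau n ` K \<subseteq> ?I" using K by (rule tau_image_subset)
  have r_refl: "r = int (card (perms_with_descent_tops n (tau n ` K)))"
    using card_perms_with_descent_tops_complement[OF K] by (simp add: r_def)

  have diff: "?I - K - J = ?I - (K \<union> J)" for J by blast
  have sign: "card (?I - K - J) = n - card (K \<union> J)" if "J \<subseteq> ?I - K" for J
  proof -
    have "K \<union> J \<subseteq> ?I" using K that by blast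
    then show ?thesis unfolding diff by (subst card_Diff_subset) (auto intro: finite_subset)
  qed
  have sign_tau: "card (tau n ` K \<union> tau n ` J) = card (K \<union> J)" if "J \<subseteq> ?I - K" for J
    unfolding image_Un[symmetric] using K that by (intro card_tau_image) blast

  have e1: "r = (\<Sum>J | J \<subseteq> ?I - K. (-1) ^ card (?I - (K \<union> J)) * ?F J)"
    unfolding r_def diff[symmetric] by (rule card_perms_with_descent_tops) blast
  have e2: "r = (\<Sum>J | J \<subseteq> ?I - K. (-1) ^ (n - card (K \<union> J)) * ?F J)"
    unfolding e1 diff[symmetric] by (intro sum.cong refl) (simp only: sign mem_Collect_eq)
  have e3: "r = (\<Sum>J | J \<subseteq> ?I - K. (-1) ^ (n - card (tau n ` K \<union> tau n ` J)) * ?F J)"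
    unfolding e2 by (intro sum.cong refl) (simp only: sign_tau mem_Collect_eq)
  have tau_compl: "?I - tau n ` K = tau n ` (?I - K)"
    using tau_image_Diff[OF order_refl K] unfolding tau_image_interval by simp
  have "{J. J \<subseteq> ?I \<and> tau n ` J \<subseteq> ?I - tau n ` K} = {J. J \<subseteq> ?I - K}"
    unfolding tau_compl using tau_image_subset_iff[OF _ Diff_subset, of _ n K] by blast
  then have e4: "r = (\<Sum>J | J \<subseteq> ?I \<and> tau n ` J \<subseteq> ?I - tau n ` K.
      (-1) ^ (n - card (tau n ` K \<union> tau n ` J)) * ?F J)"
    using e3 by simp
  have e5: "r = (\<Sum>S | S \<subseteq> ?I - tau n ` K.
      (-1) ^ (n - card (tau n ` K \<union> S)) * ?F (tau n ` S))"
    unfolding e3 tau_compl sum_subsets_tau_image[OF Diff_subset]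
  proof (intro sum.cong refl)
    fix J assume "J \<in> {J. J \<subseteq> ?I - K}"
    then have "tau n ` tau n ` J = J" by (intro tau_image_image) blast
    then show "(-1) ^ (n - card (tau n ` K \<union> tau n ` J)) * ?F J
        = (-1) ^ (n - card (tau n ` K \<union> tau n ` J)) * ?F (tau n ` tau n ` J)" by simp
  qed

  have inv: "r = (\<Sum>S | S \<subseteq> tau n ` K. (-1) ^ card (tau n ` K - S) * ?F S)"
    unfolding r_refl using tK by (rule card_perms_with_descent_tops)
  have "{S. S \<subseteq> ?I \<and> S \<subseteq> tau n ` K} = {S. S \<subseteq> tau n ` K}" using tK by auto
  then have e6: "r = (\<Sum>S | S \<subseteq> ?I \<and> S \<subseteq> tau n ` K. (-1) ^ card (tau n ` K - S) * ?F S)"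
    using inv by simp
  have below_K: "{J. J \<subseteq> ?I \<and> J \<subseteq> K} = {J. J \<subseteq> K}" using K by auto
  have e8: "r = (\<Sum>J | J \<subseteq> ?I \<and> J \<subseteq> K. (-1) ^ card (tau n ` K - tau n ` J) * ?F (tau n ` J))"
    unfolding below_K inv using K by (rule sum_subsets_tau_image)
  have "{J. J \<subseteq> ?I \<and> tau n ` J \<subseteq> tau n ` K} = {J. J \<subseteq> ?I \<and> J \<subseteq> K}"
    using tau_image_subset_iff[OF _ K] by auto
  then have e7: "r = (\<Sum>J | J \<subseteq> ?I \<and> tau n ` J \<subseteq> tau n ` K.
      (-1) ^ card (tau n ` K - tau n ` J) * ?F (tau n ` J))"
    using e8 by simp
  have reflected: "int (card (perms_with_descent_tops n (?I - L)))
      = (\<Sum>J | J \<subseteq> L. (-1) ^ card (L - J) * ?F (tau n ` J))" if "L \<subseteq> ?I" for L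
  proof -
    have "card (tau n ` L - tau n ` J) = card (L - J)" if "J \<subseteq> L" for J
      using \<open>L \<subseteq> ?I\<close> that card_tau_image[of "L - J" n] tau_image_Diff[of L n J] by auto
    then show ?thesis
      unfolding card_perms_with_descent_tops_complement[OF that]
        card_perms_with_descent_tops[OF tau_image_subset[OF that]] sum_subsets_tau_image[OF that]
      by (intro sum.cong refl) simp
  qed
  have e9: "r = (\<Sum>J | J \<subseteq> ?I \<and> J \<subseteq> K. (-1) ^ card (K - J) * ?F (tau n ` J))"
    unfolding below_K r_def using K by (rule reflected)
  have "{J. J \<subseteq> ?I \<and> tau n ` J \<subseteq> K} = {J. J \<subseteq> tau n ` K}"
  proof -
    have "J \<subseteq> ?I \<and> tau n ` J \<subseteq> K \<longleftrightarrow> J \<subseteq> tau n ` K" for J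
      using tau_image_subset_iff[OF _ tK, of J] tK unfolding tau_image_image[OF K] by blast
    then show ?thesis by simp
  qed
  moreover have "(\<Sum>J | J \<subseteq> tau n ` K. (-1) ^ card (K - tau n ` J) * ?F J)
      = (\<Sum>J | J \<subseteq> K. (-1) ^ card (K - J) * ?F (tau n ` J))"
    unfolding sum_subsets_tau_image[OF K]
  proof (intro sum.cong refl)
    fix J assume "J \<in> {J. J \<subseteq> K}"
    then have "tau n ` tau n ` J = J" using K by (intro tau_image_image) blast
    then show "(-1) ^ card (K - tau n ` tau n ` J) * ?F (tau n ` J)
        = (-1) ^ card (K - J) * ?F (tau n ` J)" by simp
  qed
  ultimately have e10: "r = (\<Sum>J | J \<subseteq> ?I \<and> tau n ` J \<subseteq> K. (-1) ^ card (K - tau n ` J) * ?F J)"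
    using e9 unfolding below_K by simp

  \<comment> \<open>The additional identity is the reflected expansion for the complement of \<open>K\<close>.\<close>
  have "(\<Sum>J | J \<subseteq> ?I - K. (-1) ^ (n - card (K \<union> J)) * ?F (tau n ` J))
      = (\<Sum>J | J \<subseteq> ?I - K. (-1) ^ card (?I - K - J) * ?F (tau n ` J))"
    by (intro sum.cong refl) (simp only: sign mem_Collect_eq)
  also have "\<dots> = int (card (perms_with_descent_tops n K))"
    using reflected[of "?I - K"] K by (simp only: double_diff[OF K order_refl] Diff_subset)
  also have "\<dots> = (\<Sum>J | J \<subseteq> ?I \<and> J \<subseteq> K. (-1) ^ card (K - J) * ?F J)"
    unfolding below_K using K by (rule card_perms_with_descent_tops)
  finally have extra: "(\<Sum>J | J \<subseteq> ?I - K. (-1) ^ (n - card (K \<union> J)) * ?F (tau n ` J))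
      = (\<Sum>J | J \<subseteq> ?I \<and> J \<subseteq> K. (-1) ^ card (K - J) * ?F J)" .

  show ?thesis
    unfolding Let_def r_def[symmetric]
    by (intro conjI e1 e2 e3 e4 e5 e6 e7 e8 e9 e10 r_refl extra)
qed

end
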